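(* Let $t\ge 2$ and $k\ge 1$ be given integers. Then ${\rm forb}(m,t\cdot F_{0,k,k,0})$ is $\Theta(m^k)$ as $m\to\infty$.
   Context: A matrix is simple if it is a (0,1)-matrix with no repeated columns. For (0,1)-matrices $F$ and $A$, $F$ is a configuration in $A$, written $F\prec A$, if some row and column permutation of $F$ is a submatrix of $A$. For a finite family $\mathcal F$ of (0,1)-matrices (not necessarily simple), ${\rm forb}(m,\mathcal F)$ is the maximum number of columns of an $m$-rowed simple matrix $A$ with $F\not\prec A$ for all $F\in\mathcal F$; for a single matrix, ${\rm forb}(m,F)={\rm forb}(m,\{F\})$. For a matrix $M$, $t\cdot M=[M\,|\,M\,|\cdots|\,M]$ is the concatenation of $t$ copies of $M$. $F_{e,f,g,h}$ denotes the $(e+f+g+h)\times 2$ (0,1)-matrix with $e$ rows $[1\,1]$, $f$ rows $[1\,0]$, $g$ rows $[0\,1]$ and $h$ rows $[0\,0]$. The asymptotics are in $m$ with $t,k$ fixed. *)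

theory Defs
  imports
    "HOL-Combinatorics.Permutations"
    "HOL-Library.Landau_Symbols"
    "Jordan_Normal_Form.Matrix"
    "Jordan_Normal_Form.DL_Submatrix"
begin

definition zero_one_mat :: "nat mat \<Rightarrow> bool" where
  "zero_one_mat A \<longleftrightarrow> elements_mat A \<subseteq> {0, 1}"

definition simple_mat :: "nat mat \<Rightarrow> bool" where
  "simple_mat A \<longleftrightarrow> zero_one_mat A \<and> distinct (cols A)"

definition configuration_in :: "nat mat \<Rightarrow> nat mat \<Rightarrow> bool" where
  "configuration_in F A \<longleftrightarrow>
     (\<exists>p q I J. p permutes {..<dim_row F} \<and> q permutes {..<dim_col F} \<and>
        I \<subseteq> {..<dim_row A} \<and> J \<subseteq> {..<dim_col A} \<and>
        mat (dim_row F) (dim_col F) (\<lambda>(i, j). F $$ (p i, q j)) = submatrix A I J)"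

definition forb_col_counts :: "nat \<Rightarrow> nat mat set \<Rightarrow> nat set" where
  "forb_col_counts m \<F> =
     {dim_col A | A. simple_mat A \<and> dim_row A = m \<and> (\<forall>F\<in>\<F>. \<not> configuration_in F A)}"

definition forb :: "nat \<Rightarrow> nat mat set \<Rightarrow> nat" where
  "forb m \<F> = Max (forb_col_counts m \<F>)"

definition repeat_mat :: "nat \<Rightarrow> nat mat \<Rightarrow> nat mat" where
  "repeat_mat t M = mat (dim_row M) (t * dim_col M) (\<lambda>(i, j). M $$ (i, j mod dim_col M))"

definition F_mat :: "nat \<Rightarrow> nat \<Rightarrow> nat \<Rightarrow> nat \<Rightarrow> nat mat" where
  "F_mat e f g h = mat_of_rows_list 2
     (replicate e [1, 1] @ replicate f [1, 0] @ replicate g [0, 1] @ replicate h [0, 0])"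

text \<open>The maximum in \<open>forb\<close> is over a finite set, which is nonempty as soon as every
  forbidden matrix has a column.\<close>

lemma simple_mat_dim_col_le:
  assumes "simple_mat A"
  shows "dim_col A \<le> 2 ^ dim_row A"
proof -
  let ?f = "\<lambda>v :: nat vec. {i. i < dim_row A \<and> v $ i = 1}"
  have entries: "v $ i \<in> {0, 1}" if "v \<in> set (cols A)" "i < dim_row A" for v i
  proof -
    obtain j where "j < dim_col A" "v = col A j"
      using \<open>v \<in> set (cols A)\<close> by (auto simp: cols_def)
    moreover have "A $$ (i, j) \<in> elements_mat A"
      using that \<open>j < dim_col A\<close> by auto
    ultimately show ?thesis
      using assms that by (auto simp: simple_mat_def zero_one_mat_def)
  qed
  have dims: "dim_vec v = dim_row A" if "v \<in> set (cols A)" for v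
    using that by (auto simp: cols_def)
  have "inj_on ?f (set (cols A))"
  proof (rule inj_onI)
    fix v w assume vw: "v \<in> set (cols A)" "w \<in> set (cols A)" and eq: "?f v = ?f w"
    show "v = w"
    proof (rule eq_vecI)
      fix i assume "i < dim_vec w"
      then have "i < dim_row A" using dims vw by simp
      moreover from this have "v $ i = 1 \<longleftrightarrow> w $ i = 1" using eq by blast
      ultimately show "v $ i = w $ i" using entries[OF vw(1)] entries[OF vw(2)] by fastforce
    qed (use dims vw in simp)
  qed
  moreover have "?f ` set (cols A) \<subseteq> Pow {..<dim_row A}" by auto
  ultimately have "card (set (cols A)) \<le> card (Pow {..<dim_row A})"
    by (intro card_inj_on_le[of ?f]) auto
  moreover have "card (set (cols A)) = dim_col A"
    using assms by (simp add: simple_mat_def distinct_card)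
  ultimately show ?thesis by (simp add: card_Pow)
qed

lemma finite_forb_col_counts: "finite (forb_col_counts m \<F>)"
  by (rule finite_subset[of _ "{..2 ^ m}"])
     (use simple_mat_dim_col_le in \<open>auto simp: forb_col_counts_def\<close>)

lemma forb_col_counts_nonempty:
  assumes "\<And>F. F \<in> \<F> \<Longrightarrow> dim_col F > 0"
  shows "forb_col_counts m \<F> \<noteq> {}"
proof -
  let ?A = "0\<^sub>m m 0 :: nat mat"
  have "simple_mat ?A"
    by (auto simp: simple_mat_def zero_one_mat_def cols_def elements_mat_def)
  moreover have "\<not> configuration_in F ?A" if "F \<in> \<F>" for F
  proof
    assume "configuration_in F ?A"
    then obtain p q I J where
      "mat (dim_row F) (dim_col F) (\<lambda>(i, j). F $$ (p i, q j)) = submatrix ?A I J"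
      unfolding configuration_in_def by blast
    then have "dim_col F = dim_col (submatrix ?A I J)"
      by (metis dim_col_mat(1))
    then show False using assms[OF that] by (simp add: dim_submatrix)
  qed
  ultimately have "dim_col ?A \<in> forb_col_counts m \<F>"
    unfolding forb_col_counts_def using index_zero_mat(2) by blast
  then show ?thesis by blast
qed

end

theory Submission
  imports Defs "HOL-Library.Ramsey"
begin

text \<open>
  Identify the columns of a simple matrix with a family \<open>\<F>\<close> of subsets of the set of rows. The
  configuration is a pair of \<open>k\<close>-sets \<open>S\<close>, \<open>T\<close> such that at least \<open>t\<close> members of \<open>\<F>\<close> contain \<open>S\<close>
  and avoid \<open>T\<close>, and at least \<open>t\<close> contain \<open>T\<close> and avoid \<open>S\<close>. The \<open>k\<close>-sets of rows have no such
  pair when \<open>t \<ge> 2\<close>, because only one of them contains \<open>S\<close>.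

  For the upper bound, reveal the members of \<open>\<F>\<close> one row at a time. When the trace of a given
  member is first shared by fewer than \<open>2t\<close> members, the trace one row earlier has extensions on
  both sides, at least \<open>t\<close> of them on one side. The traces \<open>\<E>\<close> on a fixed set \<open>X\<close> of rows with this
  property satisfy two conditions: there are no \<open>A\<close>, \<open>B\<close> in \<open>\<E>\<close> with \<open>|A - B|\<close> and \<open>|B - A|\<close> both
  at least \<open>k\<close>, and (up to complementation) if \<open>|S| = k - 1\<close>, \<open>|T| = k\<close> and some member of \<open>\<E>\<close>
  contains \<open>T\<close> and avoids \<open>S\<close>, then fewer than \<open>t\<close> members contain \<open>S\<close> and avoid \<open>T\<close>. Split \<open>\<E>\<close>
  into layers of sets of equal size. A layer has at most as many members as it shatters sets
  (Pajor), it shatters no \<open>k\<close>-set, and each \<open>(k - 1)\<close>-set is shattered by boundedly many layers. So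
  \<open>|\<E>| = O(|X|\<^sup>k\<^sup>-\<^sup>1)\<close>, and summing over the rows gives \<open>|\<F>| = O(m\<^sup>k)\<close>.
\<close>

section \<open>Crossing pairs and shattered sets\<close>

definition sep :: "'a set set \<Rightarrow> 'a set \<Rightarrow> 'a set \<Rightarrow> 'a set set" where
  "sep \<F> S T = {A \<in> \<F>. S \<subseteq> A \<and> A \<inter> T = {}}"

definition crossing :: "nat \<Rightarrow> nat \<Rightarrow> nat \<Rightarrow> nat \<Rightarrow> 'a set set \<Rightarrow> bool" where
  "crossing a b s t \<F> \<longleftrightarrow>
     (\<exists>S\<in>[UNIV]\<^bsup>a\<^esup>. \<exists>T\<in>[UNIV]\<^bsup>b\<^esup>. s \<le> card (sep \<F> S T) \<and> t \<le> card (sep \<F> T S))"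

definition shatters :: "'a set set \<Rightarrow> 'a set \<Rightarrow> bool" where
  "shatters \<F> Y \<longleftrightarrow> (\<forall>Z\<subseteq>Y. \<exists>A\<in>\<F>. A \<inter> Y = Z)"

lemma sep_subset: "sep \<F> S T \<subseteq> \<F>"
  by (auto simp: sep_def)

lemma finite_sep: "finite \<F> \<Longrightarrow> finite (sep \<F> S T)"
  by (rule finite_subset[OF sep_subset])

lemma sep_antimono: "S \<subseteq> S' \<Longrightarrow> T \<subseteq> T' \<Longrightarrow> sep \<F> S' T' \<subseteq> sep \<F> S T"
  by (auto simp: sep_def)

lemma crossingI:
  assumes "finite S" "card S = a" "finite T" "card T = b"
    and "s \<le> card (sep \<F> S T)" "t \<le> card (sep \<F> T S)"
  shows "crossing a b s t \<F>"
  using assms unfolding crossing_def nsets_def by blast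

lemma shatters_mono: "shatters \<F> Y \<Longrightarrow> \<F> \<subseteq> \<G> \<Longrightarrow> shatters \<G> Y"
  unfolding shatters_def by (meson subsetD)

lemma shatters_supersetE:
  assumes "shatters \<F> Y"
  obtains A where "A \<in> \<F>" "Y \<subseteq> A"
  using assms unfolding shatters_def by (metis inf.absorb_iff2 order_refl)

lemma shatters_disjointE:
  assumes "shatters \<F> Y"
  obtains A where "A \<in> \<F>" "A \<inter> Y = {}"
  using assms unfolding shatters_def by (metis empty_subsetI)

lemma shatters_insert:
  assumes x0: "shatters (sep \<F> {} {x}) Y" and x1: "shatters (sep \<F> {x} {}) Y"
  shows "shatters \<F> (insert x Y)"
  unfolding shatters_def
proof (intro allI impI)
  fix Z assume "Z \<subseteq> insert x Y"
  then have Z: "Z - {x} \<subseteq> Y" by blast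
  obtain A B where "A \<in> sep \<F> {} {x}" "A \<inter> Y = Z - {x}" "B \<in> sep \<F> {x} {}" "B \<inter> Y = Z - {x}"
    using x0 x1 Z unfolding shatters_def by meson
  then have "A \<in> \<F>" "B \<in> \<F>" "A \<inter> insert x Y = Z - {x}" "B \<inter> insert x Y = insert x Z"
    by (auto simp: sep_def)
  then show "\<exists>A\<in>\<F>. A \<inter> insert x Y = Z"
    by (cases "x \<in> Z") (metis insert_absorb, metis Diff_empty Diff_insert0)
qed

lemma card_shattered_split_le:
  assumes "finite (\<Union>\<F>)"
  shows "card {Y. shatters (sep \<F> {} {x}) Y} + card {Y. shatters (sep \<F> {x} {}) Y}
    \<le> card {Y. shatters \<F> Y}"
proof -
  define S0 where "S0 = {Y. shatters (sep \<F> {} {x}) Y}"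
  define S1 where "S1 = {Y. shatters (sep \<F> {x} {}) Y}"
  have sub: "S0 \<union> S1 \<union> insert x ` (S0 \<inter> S1) \<subseteq> {Y. shatters \<F> Y}"
    using shatters_mono[OF _ sep_subset] shatters_insert by (fastforce simp: S0_def S1_def)
  have "{Y. shatters \<F> Y} \<subseteq> Pow (\<Union>\<F>)"
    by (auto elim: shatters_supersetE)
  then have fin: "finite {Y. shatters \<F> Y}"
    using assms finite_subset by auto
  then have fin01: "finite S0" "finite S1"
    using sub by (auto intro: finite_subset)
  have notin: "x \<notin> Y" if "Y \<in> S0 \<union> S1" for Y
    using that by (auto simp: S0_def S1_def sep_def shatters_def)
  have "card S0 + card S1 = card (S0 \<union> S1) + card (S0 \<inter> S1)"
    using fin01 by (rule card_Un_Int)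
  also have "card (S0 \<inter> S1) = card (insert x ` (S0 \<inter> S1))"
    using notin by (intro card_image[symmetric] inj_onI) (simp add: insert_ident)
  also have "card (S0 \<union> S1) + \<dots> = card (S0 \<union> S1 \<union> insert x ` (S0 \<inter> S1))"
    using notin fin01 by (intro card_Un_disjoint[symmetric]) auto
  also have "\<dots> \<le> card {Y. shatters \<F> Y}"
    using fin sub by (rule card_mono)
  finally show ?thesis by (simp add: S0_def S1_def)
qed

lemma card_le_card_shattered:
  assumes "finite (\<Union>\<F>)"
  shows "card \<F> \<le> card {Y. shatters \<F> Y}"
proof -
  have "finite \<F>" using assms by (rule finite_UnionD)
  then show ?thesis using assms
  proof (induction \<F> rule: finite_psubset_induct)
    case (psubset \<F>)
    consider (empty) "\<F> = {}" | (singleton) A where "\<F> = {A}"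
      | (split) A B where "A \<in> \<F>" "B \<in> \<F>" "\<not> A \<subseteq> B"
      by (metis is_singletonI' is_singleton_the_elem subset_antisym)
    then show ?case
    proof cases
      case (singleton A)
      have "{Y. shatters \<F> Y} = {{}}"
        unfolding singleton shatters_def by auto
      then show ?thesis using singleton by simp
    next
      case (split A B)
      then obtain x where x: "x \<in> A" "x \<notin> B" by blast
      let ?\<F>0 = "sep \<F> {} {x}" and ?\<F>1 = "sep \<F> {x} {}"
      have IH: "card \<G> \<le> card {Y. shatters \<G> Y}" if "\<G> \<subset> \<F>" for \<G>
        using psubset that by (meson Union_mono finite_subset psubset_imp_subset)
      have partition: "\<F> = ?\<F>0 \<union> ?\<F>1" "?\<F>0 \<inter> ?\<F>1 = {}"
        by (auto simp: sep_def)
      have "card \<F> = card ?\<F>0 + card ?\<F>1"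
        using psubset.hyps partition by (metis card_Un_disjoint finite_sep)
      also have "\<dots> \<le> card {Y. shatters ?\<F>0 Y} + card {Y. shatters ?\<F>1 Y}"
        using x split by (intro add_mono IH) (auto simp: sep_def)
      also have "\<dots> \<le> card {Y. shatters \<F> Y}"
        using psubset.prems by (rule card_shattered_split_le)
      finally show ?thesis .
    qed simp
  qed
qed

lemma card_nsets:
  assumes "finite X"
  shows "card ([X]\<^bsup>j\<^esup>) = card X choose j"
proof -
  have "[X]\<^bsup>j\<^esup> = {Y. Y \<subseteq> X \<and> card Y = j}"
    using assms by (auto simp: nsets_def intro: finite_subset)
  then show ?thesis using n_subsets[OF assms] by simp
qed

lemma card_subsets_of_card_le:
  assumes "finite X"
  shows "card {Y. Y \<subseteq> X \<and> card Y \<le> j} \<le> Suc (card X) ^ j"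
proof -
  have "{Y. Y \<subseteq> X \<and> card Y \<le> j} = (\<Union>i\<le>j. [X]\<^bsup>i\<^esup>)"
    using assms by (auto simp: nsets_def intro: finite_subset)
  then have "card {Y. Y \<subseteq> X \<and> card Y \<le> j} \<le> (\<Sum>i\<le>j. card X choose i)"
    using card_UN_le[of "{..j}" "nsets X"] assms by (simp add: card_nsets)
  also have "\<dots> \<le> (\<Sum>i\<le>j. (j choose i) * card X ^ i)"
  proof (rule sum_mono)
    fix i assume "i \<in> {..j}"
    then have "1 * card X ^ i \<le> (j choose i) * card X ^ i"
      by (intro mult_right_mono) (auto simp: Suc_le_eq)
    moreover have "card X choose i \<le> card X ^ i"
      by (cases "i \<le> card X") (auto simp: binomial_le_pow binomial_eq_0)
    ultimately show "card X choose i \<le> (j choose i) * card X ^ i" by linarith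
  qed
  also have "\<dots> = Suc (card X) ^ j"
    using binomial[of "card X" 1 j] by simp
  finally show ?thesis .
qed

section \<open>Families with bounded crossings\<close>

definition layer :: "'a set set \<Rightarrow> nat \<Rightarrow> 'a set set" where
  "layer \<E> a = {A \<in> \<E>. card A = a}"

definition crossing_const :: "nat \<Rightarrow> nat \<Rightarrow> nat" where
  "crossing_const j t = (2 * j + 1 choose Suc j) * t + j + 2"

locale low_crossing_family =
  fixes \<E> :: "'a set set" and X :: "'a set" and j t :: nat
  assumes fin_X: "finite X" and sub_X: "\<E> \<subseteq> Pow X"
    and no_cross: "\<not> crossing (Suc j) (Suc j) 1 1 \<E>"
    and no_heavy_cross: "\<not> crossing j (Suc j) t 1 \<E>"
begin

lemma finite_family: "finite \<E>"
  using fin_X sub_X by (meson finite_Pow_iff finite_subset)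

lemma finite_member: "A \<in> \<E> \<Longrightarrow> finite A"
  using fin_X sub_X finite_subset by blast

lemma card_member_le: "A \<in> \<E> \<Longrightarrow> card A \<le> card X"
  using fin_X sub_X by (intro card_mono) auto

lemma card_sep_pos: "A \<in> sep \<E> S T \<Longrightarrow> 1 \<le> card (sep \<E> S T)"
  using finite_sep[OF finite_family] by (metis One_nat_def Suc_leI card_gt_0_iff empty_iff)

lemma card_Diff_le:
  assumes "A \<in> \<E>" "B \<in> \<E>" "card A \<le> card B"
  shows "card (A - B) \<le> j"
proof (rule ccontr)
  assume "\<not> card (A - B) \<le> j"
  then have "Suc j \<le> card (A - B)" "Suc j \<le> card (B - A)"
    using assms card_le_sym_Diff[of A B] finite_member by (simp_all add: not_less_eq_eq)
  then obtain S T where S: "S \<subseteq> A - B" "card S = Suc j" "finite S"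
    and T: "T \<subseteq> B - A" "card T = Suc j" "finite T"
    by (meson obtain_subset_with_card_n)
  have "A \<in> sep \<E> S T" "B \<in> sep \<E> T S"
    using assms S T by (auto simp: sep_def)
  then have "crossing (Suc j) (Suc j) 1 1 \<E>"
    using S T card_sep_pos by (intro crossingI[of S _ T]) auto
  then show False using no_cross by blast
qed

lemma card_le_of_layer_shatters:
  assumes "shatters (layer \<E> a) Y"
  shows "card Y \<le> j"
proof -
  obtain A where A: "A \<in> \<E>" "card A = a" "Y \<subseteq> A"
    using shatters_supersetE[OF assms] by (auto simp: layer_def)
  obtain B where B: "B \<in> \<E>" "card B = a" "B \<inter> Y = {}"
    using shatters_disjointE[OF assms] by (auto simp: layer_def)
  have "card Y \<le> card (A - B)"
    using A B finite_member by (intro card_mono) auto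
  also have "\<dots> \<le> j" using A B by (intro card_Diff_le) auto
  finally show ?thesis .
qed

text \<open>The largest superset \<open>A0\<close> works: \<open>B - A0\<close> has at least \<open>2j + 1\<close> points, and each of the other
  supersets contains at most \<open>j\<close> of them.\<close>

lemma ex_subset_missed_by_small_supersets:
  assumes S: "card S = j" and B: "B \<in> \<E>" "B \<inter> S = {}"
    and ne: "{A \<in> \<E>. S \<subseteq> A \<and> card A + Suc j \<le> card B} \<noteq> {}" (is "?\<A> \<noteq> {}")
  obtains R where "R \<subseteq> B" "finite R" "card R = 2 * j + 1" "\<And>A. A \<in> ?\<A> \<Longrightarrow> Suc j \<le> card (R - A)"
proof -
  have fin: "finite ?\<A>" using finite_family by simp
  then have "Max (card ` ?\<A>) \<in> card ` ?\<A>" using ne by (intro Max_in) auto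
  then obtain A0 where A0: "A0 \<in> \<E>" "S \<subseteq> A0" "card A0 + Suc j \<le> card B"
    and A0_max: "card A0 = Max (card ` ?\<A>)"
    by auto
  have "S \<subseteq> A0 - B" using A0 B by blast
  then have "j \<le> card (A0 - B)"
    using S A0 finite_member by (metis card_mono finite_Diff)
  then have "2 * j + 1 \<le> card (B - A0)"
    using A0 B finite_member card_Int_Diff[of A0 B] card_Int_Diff[of B A0]
    by (simp add: Int_commute)
  then obtain R where R: "R \<subseteq> B - A0" "card R = 2 * j + 1" "finite R"
    by (rule obtain_subset_with_card_n)
  have "Suc j \<le> card (R - A)" if A: "A \<in> ?\<A>" for A
  proof -
    have "card (R \<inter> A) \<le> card (A - A0)"
      using A R finite_member by (intro card_mono) auto
    also have "\<dots> \<le> j"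
      using A A0 A0_max fin by (intro card_Diff_le) auto
    finally show ?thesis using R card_Int_Diff[of R A] by simp
  qed
  then show ?thesis using R by (intro that) auto
qed

lemma card_small_supersets_le:
  assumes S: "finite S" "card S = j" and B: "B \<in> \<E>" "B \<inter> S = {}"
  shows "card {A \<in> \<E>. S \<subseteq> A \<and> card A + Suc j \<le> card B} \<le> (2 * j + 1 choose Suc j) * t"
    (is "card ?\<A> \<le> _")
proof (cases "?\<A> = {}")
  case True
  then show ?thesis by (simp only: card.empty le0)
next
  case False
  then obtain R where R: "R \<subseteq> B" "finite R" "card R = 2 * j + 1"
    and missed: "\<And>A. A \<in> ?\<A> \<Longrightarrow> Suc j \<le> card (R - A)"
    using ex_subset_missed_by_small_supersets[OF S(2) B] by blast
  have "?\<A> \<subseteq> (\<Union>T\<in>[R]\<^bsup>Suc j\<^esup>. sep \<E> S T)"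
  proof
    fix A assume A: "A \<in> ?\<A>"
    then obtain T where T: "T \<subseteq> R - A" "card T = Suc j" "finite T"
      using missed by (meson obtain_subset_with_card_n)
    then have "A \<in> sep \<E> S T" "T \<in> [R]\<^bsup>Suc j\<^esup>"
      using A by (auto simp: sep_def nsets_def)
    then show "A \<in> (\<Union>T\<in>[R]\<^bsup>Suc j\<^esup>. sep \<E> S T)" by blast
  qed
  then have "card ?\<A> \<le> card (\<Union>T\<in>[R]\<^bsup>Suc j\<^esup>. sep \<E> S T)"
    using R finite_family by (intro card_mono) (auto simp: finite_imp_finite_nsets finite_sep)
  also have "\<dots> \<le> (\<Sum>T\<in>[R]\<^bsup>Suc j\<^esup>. card (sep \<E> S T))"
    using R by (intro card_UN_le finite_imp_finite_nsets)
  also have "\<dots> \<le> (\<Sum>T\<in>[R]\<^bsup>Suc j\<^esup>. t)"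
  proof (rule sum_mono)
    fix T assume T: "T \<in> [R]\<^bsup>Suc j\<^esup>"
    then have "B \<in> sep \<E> T S" using B R by (auto simp: sep_def nsets_def)
    then have "\<not> t \<le> card (sep \<E> S T)"
      using S T no_heavy_cross card_sep_pos crossingI[of S j T] by (auto simp: nsets_def)
    then show "card (sep \<E> S T) \<le> t" by simp
  qed
  also have "\<dots> = (2 * j + 1 choose Suc j) * t"
    using R by (simp add: card_nsets)
  finally show ?thesis .
qed

lemma card_shattering_layers_le:
  assumes S: "finite S" "card S = j"
  shows "card {a. shatters (layer \<E> a) S} \<le> (2 * j + 1 choose Suc j) * t + Suc j"
proof (cases "{a. shatters (layer \<E> a) S} = {}")
  case False
  let ?L = "{a. shatters (layer \<E> a) S}"
  have superset: "\<exists>A\<in>\<E>. S \<subseteq> A \<and> card A = a" if "a \<in> ?L" for a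
    using that by (auto simp: layer_def elim!: shatters_supersetE)
  then have "?L \<subseteq> card ` \<E>" by blast
  then have fin: "finite ?L" using finite_family finite_surj by blast
  then have "Max ?L \<in> ?L" using False by (rule Max_in)
  then obtain B where B: "B \<in> \<E>" "B \<inter> S = {}" "card B = Max ?L"
    by (auto simp: layer_def elim: shatters_disjointE)
  let ?\<A> = "{A \<in> \<E>. S \<subseteq> A \<and> card A + Suc j \<le> card B}"
  have "?L \<subseteq> card ` ?\<A> \<union> {card B - j..card B}"
  proof
    fix a assume a: "a \<in> ?L"
    then obtain A where "A \<in> \<E>" "S \<subseteq> A" "card A = a" using superset by blast
    moreover have "a \<le> card B" using Max_ge[OF fin a] B by simp
    ultimately show "a \<in> card ` ?\<A> \<union> {card B - j..card B}" by force
  qed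
  then have "card ?L \<le> card (card ` ?\<A> \<union> {card B - j..card B})"
    using finite_family by (intro card_mono) auto
  also have "\<dots> \<le> card ?\<A> + Suc j"
    using finite_family by (intro order_trans[OF card_Un_le] add_mono card_image_le) auto
  also have "\<dots> \<le> (2 * j + 1 choose Suc j) * t + Suc j"
    using card_small_supersets_le[OF S B(1,2)] by simp
  finally show ?thesis .
qed simp

lemma card_layer_le:
  "card (layer \<E> a)
    \<le> card {Y \<in> [X]\<^bsup>j\<^esup>. shatters (layer \<E> a) Y} + card {Y. Y \<subseteq> X \<and> card Y < j}"
proof -
  have layer: "\<Union>(layer \<E> a) \<subseteq> X" using sub_X by (auto simp: layer_def)
  have "card (layer \<E> a) \<le> card {Y. shatters (layer \<E> a) Y}"
    using finite_subset[OF layer fin_X] by (rule card_le_card_shattered)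
  also have "\<dots> \<le> card ({Y \<in> [X]\<^bsup>j\<^esup>. shatters (layer \<E> a) Y} \<union> {Y. Y \<subseteq> X \<and> card Y < j})"
  proof (rule card_mono)
    show "{Y. shatters (layer \<E> a) Y}
        \<subseteq> {Y \<in> [X]\<^bsup>j\<^esup>. shatters (layer \<E> a) Y} \<union> {Y. Y \<subseteq> X \<and> card Y < j}"
    proof
      fix Y assume "Y \<in> {Y. shatters (layer \<E> a) Y}"
      then have Y: "shatters (layer \<E> a) Y" by simp
      then have "Y \<subseteq> X" using layer by (auto elim: shatters_supersetE)
      moreover have "finite Y" using \<open>Y \<subseteq> X\<close> fin_X by (rule finite_subset)
      ultimately show "Y \<in> {Y \<in> [X]\<^bsup>j\<^esup>. shatters (layer \<E> a) Y} \<union> {Y. Y \<subseteq> X \<and> card Y < j}"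
        using card_le_of_layer_shatters[OF Y] Y by (auto simp: nsets_def)
    qed
  qed (use fin_X in \<open>simp add: finite_imp_finite_nsets\<close>)
  also have "\<dots> \<le> card {Y \<in> [X]\<^bsup>j\<^esup>. shatters (layer \<E> a) Y} + card {Y. Y \<subseteq> X \<and> card Y < j}"
    by (rule card_Un_le)
  finally show ?thesis .
qed

lemma sum_card_shattered_nsets_le:
  "(\<Sum>a\<le>card X. card {Y \<in> [X]\<^bsup>j\<^esup>. shatters (layer \<E> a) Y})
    \<le> ((2 * j + 1 choose Suc j) * t + Suc j) * Suc (card X) ^ j"
proof -
  let ?c = "(2 * j + 1 choose Suc j) * t + Suc j"
  have "(\<Sum>a\<le>card X. card {Y \<in> [X]\<^bsup>j\<^esup>. shatters (layer \<E> a) Y})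
      = (\<Sum>Y\<in>[X]\<^bsup>j\<^esup>. card {a \<in> {..card X}. shatters (layer \<E> a) Y})"
    using fin_X by (intro sum_multicount_gen finite_imp_finite_nsets) auto
  also have "\<dots> \<le> (\<Sum>Y\<in>[X]\<^bsup>j\<^esup>. ?c)"
  proof (rule sum_mono)
    fix Y assume "Y \<in> [X]\<^bsup>j\<^esup>"
    then have "card {a. shatters (layer \<E> a) Y} \<le> ?c"
      by (intro card_shattering_layers_le) (auto simp: nsets_def)
    moreover have "{a \<in> {..card X}. shatters (layer \<E> a) Y} = {a. shatters (layer \<E> a) Y}"
    proof -
      have "a \<le> card X" if layer: "shatters (layer \<E> a) Y" for a
      proof -
        obtain A where "A \<in> layer \<E> a" by (rule shatters_supersetE[OF layer])
        then show ?thesis using card_member_le by (auto simp: layer_def)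
      qed
      then show ?thesis by auto
    qed
    ultimately show "card {a \<in> {..card X}. shatters (layer \<E> a) Y} \<le> ?c" by simp
  qed
  also have "\<dots> = ?c * card ([X]\<^bsup>j\<^esup>)" by simp
  also have "\<dots> \<le> ?c * card {Y. Y \<subseteq> X \<and> card Y \<le> j}"
    using fin_X by (intro mult_left_mono card_mono) (auto simp: nsets_def)
  also have "\<dots> \<le> ?c * Suc (card X) ^ j"
    using fin_X by (intro mult_left_mono card_subsets_of_card_le) auto
  finally show ?thesis .
qed

lemma card_family_le: "card \<E> \<le> crossing_const j t * Suc (card X) ^ j"
proof -
  have "(\<Union>a\<le>card X. layer \<E> a) = \<E>"
    using card_member_le by (auto simp: layer_def)
  then have "card \<E> \<le> (\<Sum>a\<le>card X. card (layer \<E> a))"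
    using card_UN_le[of "{..card X}" "layer \<E>"] by simp
  also have "\<dots> \<le> (\<Sum>a\<le>card X. card {Y \<in> [X]\<^bsup>j\<^esup>. shatters (layer \<E> a) Y}
      + card {Y. Y \<subseteq> X \<and> card Y < j})"
    by (intro sum_mono card_layer_le)
  also have "\<dots> = (\<Sum>a\<le>card X. card {Y \<in> [X]\<^bsup>j\<^esup>. shatters (layer \<E> a) Y})
      + Suc (card X) * card {Y. Y \<subseteq> X \<and> card Y < j}"
    by (simp add: sum.distrib)
  also have "Suc (card X) * card {Y. Y \<subseteq> X \<and> card Y < j} \<le> Suc (card X) ^ j"
  proof (cases j)
    case (Suc i)
    then show ?thesis
      using mult_le_mono2[OF card_subsets_of_card_le[OF fin_X, of i], of "Suc (card X)"]
      by (simp add: less_Suc_eq_le)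
  qed simp
  finally show ?thesis
    using sum_card_shattered_nsets_le by (simp add: crossing_const_def)
qed

end

section \<open>Traces\<close>

text \<open>For \<open>P \<subseteq> X\<close>, the members of \<open>\<F>\<close> with trace \<open>P\<close> on \<open>X\<close> are those in \<open>sep \<F> P (X - P)\<close>.\<close>

definition avoiding_branchings :: "nat \<Rightarrow> 'a set set \<Rightarrow> 'a set \<Rightarrow> 'a \<Rightarrow> 'a set set" where
  "avoiding_branchings t \<F> X x =
     {P. P \<subseteq> X \<and> t \<le> card (sep \<F> P (insert x (X - P))) \<and> sep \<F> (insert x P) (X - P) \<noteq> {}}"

lemma card_sep_ge_of_avoiding_branching:
  assumes "finite \<F>" "P \<in> avoiding_branchings t \<F> X x" "S \<subseteq> P" "T \<subseteq> insert x X" "P \<inter> T = {}"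
  shows "t \<le> card (sep \<F> S T)"
proof -
  have "sep \<F> P (insert x (X - P)) \<subseteq> sep \<F> S T"
    using assms(3-5) by (intro sep_antimono) auto
  then have "card (sep \<F> P (insert x (X - P))) \<le> card (sep \<F> S T)"
    using assms(1) by (intro card_mono finite_sep)
  then show ?thesis using assms(2) by (simp add: avoiding_branchings_def)
qed

lemma not_crossing_avoiding_branchings:
  assumes "finite \<F>" and free: "\<not> crossing k k t t \<F>" and "t \<ge> 1"
  shows "\<not> crossing k k 1 1 (avoiding_branchings t \<F> X x)"
proof
  let ?\<E> = "avoiding_branchings t \<F> X x"
  assume "crossing k k 1 1 ?\<E>"
  then obtain S T where ST: "S \<in> [UNIV]\<^bsup>k\<^esup>" "T \<in> [UNIV]\<^bsup>k\<^esup>"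
      and "1 \<le> card (sep ?\<E> S T)" "1 \<le> card (sep ?\<E> T S)"
    unfolding crossing_def by blast
  then have "sep ?\<E> S T \<noteq> {}" "sep ?\<E> T S \<noteq> {}" by auto
  then obtain A B where A: "A \<in> ?\<E>" "S \<subseteq> A" "A \<inter> T = {}" and B: "B \<in> ?\<E>" "T \<subseteq> B" "B \<inter> S = {}"
    unfolding sep_def by blast
  then have "S \<subseteq> X" "T \<subseteq> X" by (auto simp: avoiding_branchings_def)
  then have "t \<le> card (sep \<F> S T)" "t \<le> card (sep \<F> T S)"
    using A B card_sep_ge_of_avoiding_branching[OF assms(1), of _ t X x] by (meson subset_insertI2)+
  then show False using free ST unfolding crossing_def by blast
qed

lemma card_sep_avoiding_branchings_le:
  assumes "finite \<F>" "T \<subseteq> X"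
  shows "card (sep (avoiding_branchings t \<F> X x) S T) \<le> card (sep \<F> (insert x S) T)"
proof -
  let ?\<A> = "sep (avoiding_branchings t \<F> X x) S T"
  define ext where "ext A = (SOME C. C \<in> sep \<F> (insert x A) (X - A))" for A
  have ext: "ext A \<in> sep \<F> (insert x A) (X - A)" if "A \<in> ?\<A>" for A
    using subsetD[OF sep_subset that] by (simp add: ext_def some_in_eq avoiding_branchings_def)
  have "ext A \<inter> X = A" if "A \<in> ?\<A>" for A
    using ext[OF that] that by (auto simp: sep_def avoiding_branchings_def)
  then have "inj_on ext ?\<A>" by (rule inj_on_inverseI)
  moreover have "ext ` ?\<A> \<subseteq> sep \<F> (insert x S) T"
  proof (rule image_subsetI)
    fix A assume A: "A \<in> ?\<A>"
    have "sep \<F> (insert x A) (X - A) \<subseteq> sep \<F> (insert x S) T"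
      using A assms(2) by (intro sep_antimono) (auto simp: sep_def)
    then show "ext A \<in> sep \<F> (insert x S) T" using ext[OF A] by blast
  qed
  ultimately show ?thesis
    using assms(1) by (intro card_inj_on_le[of ext] finite_sep)
qed

lemma not_heavy_crossing_avoiding_branchings:
  assumes fin: "finite \<F>" and x: "x \<notin> X"
    and free: "\<not> crossing (Suc j) (Suc j) t t \<F>" and t: "t \<ge> 1"
  shows "\<not> crossing j (Suc j) t 1 (avoiding_branchings t \<F> X x)"
proof
  let ?\<E> = "avoiding_branchings t \<F> X x"
  assume "crossing j (Suc j) t 1 ?\<E>"
  then obtain S T where S: "finite S" "card S = j" and T: "finite T" "card T = Suc j"
      and heavy: "t \<le> card (sep ?\<E> S T)" and "1 \<le> card (sep ?\<E> T S)"
    unfolding crossing_def nsets_def by blast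
  then have "sep ?\<E> S T \<noteq> {}" "sep ?\<E> T S \<noteq> {}" using t by auto
  then obtain A B where "A \<in> sep ?\<E> S T" "B \<in> sep ?\<E> T S" by blast
  then have B: "B \<in> ?\<E>" "B \<subseteq> X" "T \<subseteq> B" "B \<inter> S = {}" and sub: "S \<subseteq> X" "T \<subseteq> X"
    by (auto simp: sep_def avoiding_branchings_def)
  have "t \<le> card (sep \<F> (insert x S) T)"
    using heavy card_sep_avoiding_branchings_le[OF fin sub(2)] by (rule order_trans)
  moreover have "t \<le> card (sep \<F> T (insert x S))"
    using B sub x by (intro card_sep_ge_of_avoiding_branching[OF fin B(1)]) auto
  moreover have "card (insert x S) = Suc j"
    using S sub x by (subst card_insert_disjoint) auto
  ultimately have "crossing (Suc j) (Suc j) t t \<F>"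
    using S T by (intro crossingI[of "insert x S" _ T]) auto
  then show False using free by blast
qed

lemma card_avoiding_branchings_le:
  assumes "finite \<F>" "\<not> crossing (Suc j) (Suc j) t t \<F>" "t \<ge> 1" "finite X" "x \<notin> X"
  shows "card (avoiding_branchings t \<F> X x) \<le> crossing_const j t * Suc (card X) ^ j"
proof -
  have "avoiding_branchings t \<F> X x \<subseteq> Pow X" by (auto simp: avoiding_branchings_def)
  then interpret low_crossing_family "avoiding_branchings t \<F> X x" X j t
    using assms by (intro low_crossing_family.intro not_crossing_avoiding_branchings
      not_heavy_crossing_avoiding_branchings)
  show ?thesis by (rule card_family_le)
qed

lemma sep_uminus: "sep (uminus ` \<F>) S T = uminus ` sep \<F> T S"
  by (auto simp: sep_def)

lemma card_sep_uminus: "card (sep (uminus ` \<F>) S T) = card (sep \<F> T S)"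
  by (simp add: sep_uminus card_image inj_on_def)

lemma crossing_uminus: "crossing a b s t (uminus ` \<F>) \<longleftrightarrow> crossing b a s t \<F>"
  unfolding crossing_def card_sep_uminus by blast

definition branchings :: "nat \<Rightarrow> 'a set set \<Rightarrow> 'a set \<Rightarrow> 'a \<Rightarrow> 'a set set" where
  "branchings t \<F> X x =
     {P. P \<subseteq> X \<and> sep \<F> P (insert x (X - P)) \<noteq> {} \<and> sep \<F> (insert x P) (X - P) \<noteq> {} \<and>
        (t \<le> card (sep \<F> P (insert x (X - P))) \<or> t \<le> card (sep \<F> (insert x P) (X - P)))}"

lemma branchings_subset:
  "branchings t \<F> X x
    \<subseteq> avoiding_branchings t \<F> X x \<union> (-) X ` avoiding_branchings t (uminus ` \<F>) X x"
proof
  fix P assume "P \<in> branchings t \<F> X x"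
  then have P: "P = X - (X - P)"
    and "P \<in> avoiding_branchings t \<F> X x \<or> X - P \<in> avoiding_branchings t (uminus ` \<F>) X x"
    by (auto simp: branchings_def avoiding_branchings_def sep_uminus card_image inj_on_def
        double_diff)
  then show "P \<in> avoiding_branchings t \<F> X x \<union> (-) X ` avoiding_branchings t (uminus ` \<F>) X x"
    by (metis UnI1 UnI2 imageI)
qed

lemma card_branchings_le:
  assumes "finite \<F>" "\<not> crossing (Suc j) (Suc j) t t \<F>" "t \<ge> 1" "finite X" "x \<notin> X"
  shows "card (branchings t \<F> X x) \<le> 2 * crossing_const j t * Suc (card X) ^ j"
proof -
  let ?\<B> = "\<lambda>\<G>. avoiding_branchings t \<G> X x"
  have fin: "finite (?\<B> \<G>)" for \<G>
    using assms by (auto simp: avoiding_branchings_def)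
  have "card (branchings t \<F> X x) \<le> card (?\<B> \<F> \<union> (-) X ` ?\<B> (uminus ` \<F>))"
    using fin by (intro card_mono branchings_subset) auto
  also have "\<dots> \<le> card (?\<B> \<F>) + card (?\<B> (uminus ` \<F>))"
    by (intro order_trans[OF card_Un_le] add_left_mono card_image_le fin)
  also have "\<dots> \<le> crossing_const j t * Suc (card X) ^ j + crossing_const j t * Suc (card X) ^ j"
    using assms by (intro add_mono card_avoiding_branchings_le) (auto simp: crossing_uminus)
  finally show ?thesis by simp
qed

definition sparse_members :: "nat \<Rightarrow> 'a set set \<Rightarrow> 'a set \<Rightarrow> 'a set set" where
  "sparse_members n \<F> X = {A \<in> \<F>. card (sep \<F> (A \<inter> X) (X - A)) < n}"

lemma card_sparse_members_with_trace_le: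
  assumes "finite \<F>"
  shows "card {A \<in> sparse_members n \<F> X. A \<inter> X = Q} \<le> n" (is "card ?\<A> \<le> n")
proof (cases "?\<A> = {}")
  case True
  then show ?thesis by (simp only: card.empty le0)
next
  case False
  then obtain A where A: "A \<in> sparse_members n \<F> X" "A \<inter> X = Q" by blast
  have "card ?\<A> \<le> card (sep \<F> (A \<inter> X) (X - A))"
    using A assms by (intro card_mono finite_sep) (auto simp: sparse_members_def sep_def)
  also have "\<dots> \<le> n"
    using A by (simp add: sparse_members_def)
  finally show ?thesis .
qed

text \<open>A newly sparse member has a trace on \<open>X\<close> with at least \<open>2t\<close> extensions, fewer than \<open>2t\<close> of
  which agree with it at \<open>x\<close>. So the other side is nonempty, and one side has at least \<open>t\<close> members.\<close>

lemma trace_in_branchings: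
  assumes A: "A \<in> sparse_members (2 * t) \<F> (insert x X)" "A \<notin> sparse_members (2 * t) \<F> X"
  shows "A \<inter> X \<in> branchings t \<F> X x"
proof -
  let ?P = "A \<inter> X"
  let ?\<F>0 = "sep \<F> ?P (insert x (X - ?P))" and ?\<F>1 = "sep \<F> (insert x ?P) (X - ?P)"
  have "A \<in> \<F>" using A by (simp add: sparse_members_def)
  have "sep \<F> ?P (X - A) = ?\<F>0 \<union> ?\<F>1"
    by (auto simp: sep_def)
  then have "card (sep \<F> ?P (X - A)) \<le> card ?\<F>0 + card ?\<F>1"
    by (simp add: card_Un_le)
  then have many: "2 * t \<le> card ?\<F>0 + card ?\<F>1"
    using A by (auto simp: sparse_members_def)
  have "sep \<F> (A \<inter> insert x X) (insert x X - A) = (if x \<in> A then ?\<F>1 else ?\<F>0)"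
    by (auto simp: sep_def)
  then have few: "card (if x \<in> A then ?\<F>1 else ?\<F>0) < 2 * t"
    using A(1) by (simp add: sparse_members_def)
  have "A \<in> (if x \<in> A then ?\<F>1 else ?\<F>0)"
    using \<open>A \<in> \<F>\<close> by (auto simp: sep_def)
  moreover have "card (if x \<in> A then ?\<F>0 else ?\<F>1) \<noteq> 0"
    using many few by (auto split: if_splits)
  ultimately have "?\<F>0 \<noteq> {}" "?\<F>1 \<noteq> {}" by (auto split: if_splits)
  moreover have "t \<le> card ?\<F>0 \<or> t \<le> card ?\<F>1" using many by linarith
  ultimately show ?thesis by (simp add: branchings_def)
qed

lemma sparse_members_insert_subset:
  "sparse_members (2 * t) \<F> (insert x X) \<subseteq> sparse_members (2 * t) \<F> X \<union>
     (\<Union>Q\<in>branchings t \<F> X x \<union> insert x ` branchings t \<F> X x.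
        {A \<in> sparse_members (2 * t) \<F> (insert x X). A \<inter> insert x X = Q})"
proof
  fix A assume A: "A \<in> sparse_members (2 * t) \<F> (insert x X)"
  show "A \<in> sparse_members (2 * t) \<F> X \<union>
      (\<Union>Q\<in>branchings t \<F> X x \<union> insert x ` branchings t \<F> X x.
        {A \<in> sparse_members (2 * t) \<F> (insert x X). A \<inter> insert x X = Q})"
  proof (cases "A \<in> sparse_members (2 * t) \<F> X")
    case False
    have "A \<inter> insert x X = A \<inter> X \<or> A \<inter> insert x X = insert x (A \<inter> X)"
      by (simp add: Int_insert_right)
    then have "A \<inter> insert x X \<in> branchings t \<F> X x \<union> insert x ` branchings t \<F> X x"
      using trace_in_branchings[OF A False] by (metis UnI1 UnI2 imageI)
    then show ?thesis using A by blast
  qed simp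
qed

lemma card_sparse_members_insert_le:
  assumes fin: "finite \<F>" "finite X"
    and "x \<notin> X" "\<not> crossing (Suc j) (Suc j) t t \<F>" "t \<ge> 1"
  shows "card (sparse_members (2 * t) \<F> (insert x X)) \<le> card (sparse_members (2 * t) \<F> X)
    + 8 * t * crossing_const j t * Suc (card X) ^ j"
proof -
  let ?\<B> = "branchings t \<F> X x"
  let ?with_trace = "\<lambda>Q. {A \<in> sparse_members (2 * t) \<F> (insert x X). A \<inter> insert x X = Q}"
  have fin_B: "finite ?\<B>" using fin(2) by (auto simp: branchings_def)
  have fin_sparse: "finite (sparse_members n \<F> Y)" for n Y
    using fin(1) by (simp add: sparse_members_def)
  have "card (\<Union>Q\<in>?\<B> \<union> insert x ` ?\<B>. ?with_trace Q)
      \<le> (\<Sum>Q\<in>?\<B> \<union> insert x ` ?\<B>. card (?with_trace Q))"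
    using fin_B by (intro card_UN_le) auto
  also have "\<dots> \<le> card (?\<B> \<union> insert x ` ?\<B>) * (2 * t)"
    using sum_bounded_above[OF card_sparse_members_with_trace_le[OF fin(1)]] by simp
  also have "\<dots> \<le> (card ?\<B> + card ?\<B>) * (2 * t)"
    by (intro mult_right_mono order_trans[OF card_Un_le] add_left_mono card_image_le fin_B le0)
  also have "\<dots> = 4 * t * card ?\<B>" by simp
  also have "\<dots> \<le> 4 * t * (2 * crossing_const j t * Suc (card X) ^ j)"
    using assms by (intro mult_left_mono card_branchings_le) auto
  also have "\<dots> = 8 * t * crossing_const j t * Suc (card X) ^ j"
    by simp
  finally have new: "card (\<Union>Q\<in>?\<B> \<union> insert x ` ?\<B>. ?with_trace Q)
      \<le> 8 * t * crossing_const j t * Suc (card X) ^ j" .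
  have "card (sparse_members (2 * t) \<F> (insert x X))
      \<le> card (sparse_members (2 * t) \<F> X \<union> (\<Union>Q\<in>?\<B> \<union> insert x ` ?\<B>. ?with_trace Q))"
    using fin_B fin_sparse by (intro card_mono sparse_members_insert_subset) auto
  also have "\<dots> \<le> card (sparse_members (2 * t) \<F> X)
      + card (\<Union>Q\<in>?\<B> \<union> insert x ` ?\<B>. ?with_trace Q)"
    by (rule card_Un_le)
  finally show ?thesis using new by linarith
qed

lemma card_sparse_members_le:
  assumes "finite X" and fin: "finite \<F>" and free: "\<not> crossing (Suc j) (Suc j) t t \<F>"
    and t: "t \<ge> 1" and dense: "2 * t \<le> card \<F>"
  shows "card (sparse_members (2 * t) \<F> X) \<le> 8 * t * crossing_const j t * card X ^ Suc j"
  using assms(1)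
proof (induction X rule: finite_induct)
  case empty
  show ?case using dense by (simp add: sparse_members_def sep_def)
next
  case (insert x X)
  let ?c = "8 * t * crossing_const j t"
  have "card (sparse_members (2 * t) \<F> (insert x X)) \<le> ?c * card X ^ Suc j + ?c * Suc (card X) ^ j"
    using card_sparse_members_insert_le[OF fin insert.hyps free t] insert.IH by linarith
  also have "\<dots> = ?c * (card X * card X ^ j + Suc (card X) ^ j)"
    by (simp add: distrib_left)
  also have "\<dots> \<le> ?c * (card X * Suc (card X) ^ j + Suc (card X) ^ j)"
    by (intro mult_left_mono add_right_mono power_mono) auto
  also have "\<dots> = ?c * card (insert x X) ^ Suc j"
    using insert.hyps by simp
  finally show ?case .
qed

lemma card_le_of_not_crossing:
  assumes X: "finite X" "X \<noteq> {}" and sub: "\<F> \<subseteq> Pow X"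
    and free: "\<not> crossing (Suc j) (Suc j) t t \<F>" and t: "t \<ge> 1"
  shows "card \<F> \<le> 8 * t * crossing_const j t * card X ^ Suc j"
proof (cases "2 * t \<le> card \<F>")
  case True
  have "sep \<F> (A \<inter> X) (X - A) = {A}" if "A \<in> \<F>" for A
    using sub that by (auto simp: sep_def)
  then have "sparse_members (2 * t) \<F> X = \<F>"
    using t by (auto simp: sparse_members_def)
  moreover have "finite \<F>" using X sub by (meson finite_Pow_iff finite_subset)
  ultimately show ?thesis using card_sparse_members_le[OF X(1) _ free t True] by simp
next
  case False
  then have "card \<F> \<le> 8 * t * 1 * 1" by simp
  also have "\<dots> \<le> 8 * t * crossing_const j t * card X ^ Suc j"
    using X by (intro mult_mono) (auto simp: Suc_le_eq card_gt_0_iff crossing_const_def)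
  finally show ?thesis .
qed

section \<open>Configurations as crossings\<close>

lemma bij_betw_pick:
  assumes "finite I"
  shows "bij_betw (pick I) {..<card I} I"
proof -
  have "inj_on (pick I) {..<card I}"
    by (intro inj_onI) (metis lessThan_iff nat_neq_iff pick_mono_le)
  moreover have "pick I ` {..<card I} \<subseteq> I" using pick_in_set_le by auto
  moreover have "card (pick I ` {..<card I}) = card I"
    using calculation(1) by (simp add: card_image)
  ultimately show ?thesis using assms by (simp add: bij_betw_def card_subset_eq)
qed

lemma ex_permutes_pick:
  assumes "bij_betw r {..<n} I"
  obtains p where "p permutes {..<n}" "\<And>i. i < n \<Longrightarrow> pick I i = r (p i)"
proof -
  define p where "p i = (if i < n then inv_into {..<n} r (pick I i) else i)" for i
  have "finite I" "card I = n"
    using bij_betw_finite[OF assms] bij_betw_same_card[OF assms] by simp_all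
  then have pick: "bij_betw (pick I) {..<n} I" using bij_betw_pick[of I] by simp
  have "bij_betw (inv_into {..<n} r \<circ> pick I) {..<n} {..<n}"
    using bij_betw_trans[OF pick bij_betw_inv_into[OF assms]] .
  then have "bij_betw p {..<n} {..<n}"
    by (rule bij_betw_cong[THEN iffD1, rotated]) (simp add: p_def)
  then have "p permutes {..<n}" by (rule bij_imp_permutes) (simp add: p_def)
  moreover have "pick I i = r (p i)" if "i < n" for i
    using that bij_betwE[OF pick] bij_betw_inv_into_right[OF assms] by (simp add: p_def)
  ultimately show ?thesis by (rule that)
qed

lemma mat_eq_submatrix_iff:
  assumes I: "I \<subseteq> {..<dim_row A}" and J: "J \<subseteq> {..<dim_col A}"
  shows "mat m n f = submatrix A I J \<longleftrightarrow>
    card I = m \<and> card J = n \<and> (\<forall>i<m. \<forall>j<n. f (i, j) = A $$ (pick I i, pick J j))"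
proof -
  have "{i. i < dim_row A \<and> i \<in> I} = I" "{j. j < dim_col A \<and> j \<in> J} = J"
    using I J by auto
  then show ?thesis by (auto simp: mat_eq_iff dim_submatrix submatrix_index)
qed

lemma configuration_inI:
  assumes r: "inj_on r {..<dim_row F}" "r ` {..<dim_row F} \<subseteq> {..<dim_row A}"
    and c: "inj_on c {..<dim_col F}" "c ` {..<dim_col F} \<subseteq> {..<dim_col A}"
    and entry: "\<And>i j. i < dim_row F \<Longrightarrow> j < dim_col F \<Longrightarrow> F $$ (i, j) = A $$ (r i, c j)"
  shows "configuration_in F A"
proof -
  let ?I = "r ` {..<dim_row F}" and ?J = "c ` {..<dim_col F}"
  obtain p where p: "p permutes {..<dim_row F}" "\<And>i. i < dim_row F \<Longrightarrow> pick ?I i = r (p i)"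
    using ex_permutes_pick[OF inj_on_imp_bij_betw[OF r(1)]] by blast
  obtain q where q: "q permutes {..<dim_col F}" "\<And>j. j < dim_col F \<Longrightarrow> pick ?J j = c (q j)"
    using ex_permutes_pick[OF inj_on_imp_bij_betw[OF c(1)]] by blast
  have "F $$ (p i, q j) = A $$ (pick ?I i, pick ?J j)" if "i < dim_row F" "j < dim_col F" for i j
    using that p q entry[of "p i" "q j"] permutes_in_image[OF p(1), of i]
      permutes_in_image[OF q(1), of j]
    by simp
  then have "mat (dim_row F) (dim_col F) (\<lambda>(i, j). F $$ (p i, q j)) = submatrix A ?I ?J"
    using r c by (simp add: mat_eq_submatrix_iff card_image)
  then show ?thesis using p(1) q(1) r(2) c(2) unfolding configuration_in_def by blast
qed

lemma configuration_inE:
  assumes "configuration_in F A"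
  obtains r c where "inj_on r {..<dim_row F}" "r ` {..<dim_row F} \<subseteq> {..<dim_row A}"
    and "inj_on c {..<dim_col F}" "c ` {..<dim_col F} \<subseteq> {..<dim_col A}"
    and "\<And>i j. i < dim_row F \<Longrightarrow> j < dim_col F \<Longrightarrow> F $$ (i, j) = A $$ (r i, c j)"
proof -
  obtain p q I J where p: "p permutes {..<dim_row F}" and q: "q permutes {..<dim_col F}"
    and I: "I \<subseteq> {..<dim_row A}" and J: "J \<subseteq> {..<dim_col A}"
    and eq: "mat (dim_row F) (dim_col F) (\<lambda>(i, j). F $$ (p i, q j)) = submatrix A I J"
    using assms unfolding configuration_in_def by blast
  have card: "card I = dim_row F" "card J = dim_col F"
    and entry: "\<And>i j. i < dim_row F \<Longrightarrow> j < dim_col F \<Longrightarrow>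
      F $$ (p i, q j) = A $$ (pick I i, pick J j)"
    using eq unfolding mat_eq_submatrix_iff[OF I J] by simp_all
  have "finite I" "finite J" using I J finite_subset by blast+
  then have pick: "bij_betw (pick I) {..<dim_row F} I" "bij_betw (pick J) {..<dim_col F} J"
    using bij_betw_pick card by metis+
  note inv_p = permutes_inv[OF p] and inv_q = permutes_inv[OF q]
  define r where "r = pick I \<circ> inv_into UNIV p"
  define c where "c = pick J \<circ> inv_into UNIV q"
  have "bij_betw r {..<dim_row F} I" "bij_betw c {..<dim_col F} J"
    unfolding r_def c_def
    using bij_betw_trans[OF permutes_imp_bij[OF inv_p] pick(1)]
      bij_betw_trans[OF permutes_imp_bij[OF inv_q] pick(2)] .
  moreover have "F $$ (i, j) = A $$ (r i, c j)" if "i < dim_row F" "j < dim_col F" for i j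
    using that entry[of "inv_into UNIV p i" "inv_into UNIV q j"]
      permutes_in_image[OF inv_p, of i] permutes_in_image[OF inv_q, of j]
    by (simp add: r_def c_def permutes_inverses[OF p] permutes_inverses[OF q])
  ultimately show ?thesis using I J by (intro that[of r c]) (auto simp: bij_betw_def)
qed

lemma dim_repeat_mat [simp]:
  "dim_row (repeat_mat t M) = dim_row M" "dim_col (repeat_mat t M) = t * dim_col M"
  by (simp_all add: repeat_mat_def)

lemma dim_F_mat [simp]: "dim_row (F_mat e f g h) = e + f + g + h" "dim_col (F_mat e f g h) = 2"
  by (simp_all add: F_mat_def mat_of_rows_list_def)

lemma repeat_F_mat_index:
  assumes "i < f + g" "j < t * 2"
  shows "repeat_mat t (F_mat 0 f g 0) $$ (i, j) = of_bool (i < f \<longleftrightarrow> even j)"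
  using assms
  by (cases "even j")
    (auto simp: repeat_mat_def F_mat_def mat_of_rows_list_def nth_append
      even_iff_mod_2_eq_zero odd_iff_mod_2_eq_one)

definition col_set :: "nat mat \<Rightarrow> nat \<Rightarrow> nat set" where
  "col_set A j = {i. i < dim_row A \<and> A $$ (i, j) = 1}"

definition col_sets :: "nat mat \<Rightarrow> nat set set" where
  "col_sets A = col_set A ` {..<dim_col A}"

definition sep_cols :: "nat mat \<Rightarrow> nat set \<Rightarrow> nat set \<Rightarrow> nat set" where
  "sep_cols A S T = {j. j < dim_col A \<and> S \<subseteq> col_set A j \<and> col_set A j \<inter> T = {}}"

lemma zero_one_mat_entry:
  assumes "zero_one_mat A" "i < dim_row A" "j < dim_col A"
  shows "A $$ (i, j) = of_bool (i \<in> col_set A j)"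
  using assms by (auto simp: zero_one_mat_def col_set_def)

lemma simple_mat_iff_inj_on_col_set:
  "simple_mat A \<longleftrightarrow> zero_one_mat A \<and> inj_on (col_set A) {..<dim_col A}"
proof -
  have "col A i = col A j \<longleftrightarrow> col_set A i = col_set A j"
    if "zero_one_mat A" "i < dim_col A" "j < dim_col A" for i j
  proof
    assume eq: "col_set A i = col_set A j"
    show "col A i = col A j"
      using that by (intro eq_vecI) (auto simp: zero_one_mat_entry eq)
  next
    assume eq: "col A i = col A j"
    have "A $$ (l, i) = A $$ (l, j)" if "l < dim_row A" for l
      using arg_cong[OF eq, of "\<lambda>v. v $ l"] that \<open>i < dim_col A\<close> \<open>j < dim_col A\<close> by simp
    then show "col_set A i = col_set A j" by (auto simp: col_set_def)
  qed
  then have "inj_on (col A) {..<dim_col A} \<longleftrightarrow> inj_on (col_set A) {..<dim_col A}"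
    if "zero_one_mat A"
    using that by (simp add: inj_on_def)
  moreover have "distinct (cols A) \<longleftrightarrow> inj_on (col A) {..<dim_col A}"
    by (simp add: cols_def distinct_map atLeast0LessThan)
  ultimately show ?thesis by (auto simp: simple_mat_def)
qed

lemma card_col_sets:
  assumes "simple_mat A"
  shows "card (col_sets A) = dim_col A"
  using assms by (simp add: col_sets_def simple_mat_iff_inj_on_col_set card_image)

lemma card_sep_cols:
  assumes "simple_mat A"
  shows "card (sep_cols A S T) = card (sep (col_sets A) S T)"
proof -
  have "inj_on (col_set A) (sep_cols A S T)"
    using assms by (auto simp: simple_mat_iff_inj_on_col_set sep_cols_def intro: inj_on_subset)
  moreover have "col_set A ` sep_cols A S T = sep (col_sets A) S T"
    by (auto simp: sep_cols_def sep_def col_sets_def)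
  ultimately show ?thesis by (metis card_image)
qed

lemma ex_simple_mat_col_sets:
  assumes "\<F> \<subseteq> Pow {..<m}"
  obtains A where "simple_mat A" "dim_row A = m" "col_sets A = \<F>"
proof -
  have "finite \<F>" using assms by (meson finite_Pow_iff finite_lessThan finite_subset)
  then obtain h where h: "bij_betw h {..<card \<F>} \<F>"
    using ex_bij_betw_nat_finite by (metis atLeast0LessThan)
  define A where "A = mat m (card \<F>) (\<lambda>(i, j). of_bool (i \<in> h j) :: nat)"
  have dim: "dim_row A = m" "dim_col A = card \<F>" by (simp_all add: A_def)
  have col_set: "col_set A j = h j" if "j < card \<F>" for j
  proof -
    have "h j \<subseteq> {..<m}" using that assms bij_betwE[OF h] by blast
    then show ?thesis using that by (auto simp: col_set_def A_def of_bool_def split: if_splits)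
  qed
  have "zero_one_mat A" by (auto simp: zero_one_mat_def elements_mat_def A_def)
  moreover have "bij_betw (col_set A) {..<dim_col A} \<F>"
    unfolding dim using h by (rule bij_betw_cong[THEN iffD1, rotated]) (simp add: col_set)
  ultimately show ?thesis
    using dim(1)
    by (intro that[of A]) (simp_all add: simple_mat_iff_inj_on_col_set col_sets_def bij_betw_def)
qed

lemma ex_bij_betw_Un:
  assumes fin: "finite A" "finite B" "finite C" "finite D"
    and card: "card A = card C" "card B = card D"
    and disj: "A \<inter> B = {}" "C \<inter> D = {}"
  obtains f where "bij_betw f (A \<union> B) (C \<union> D)" "f ` A = C" "f ` B = D"
proof -
  obtain g h where "bij_betw g A C" "bij_betw h B D"
    using fin card finite_same_card_bij by metis
  define f where "f x = (if x \<in> A then g x else h x)" for x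
  have "bij_betw f (A \<union> B) (C \<union> D)"
    unfolding f_def using \<open>bij_betw g A C\<close> \<open>bij_betw h B D\<close> disj by (intro bij_betw_disjoint_Un)
  moreover have "f ` A = C" "f ` B = D"
    using \<open>bij_betw g A C\<close> \<open>bij_betw h B D\<close> disj by (auto simp: f_def bij_betw_def)
  ultimately show ?thesis by (rule that)
qed

lemma card_even_less: "card {j. j < t * 2 \<and> even j} = t"
proof -
  have "{j. j < t * 2 \<and> even j} = (\<lambda>i. 2 * i) ` {..<t}" by (auto elim!: evenE)
  then show ?thesis by (simp add: card_image inj_on_def)
qed

lemma card_odd_less: "card {j. j < t * 2 \<and> odd j} = t"
proof -
  have "{j. j < t * 2 \<and> odd j} = (\<lambda>i. 2 * i + 1) ` {..<t}" by (auto elim!: oddE)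
  then show ?thesis by (simp add: card_image inj_on_def)
qed

lemma crossing_of_configuration_in:
  assumes A: "simple_mat A" and conf: "configuration_in (repeat_mat t (F_mat 0 f g 0)) A"
  shows "crossing f g t t (col_sets A)"
proof -
  obtain r c where r: "inj_on r {..<f + g}" "r ` {..<f + g} \<subseteq> {..<dim_row A}"
    and c: "inj_on c {..<t * 2}" "c ` {..<t * 2} \<subseteq> {..<dim_col A}"
    and entry: "\<And>i j. i < f + g \<Longrightarrow> j < t * 2 \<Longrightarrow> of_bool (i < f \<longleftrightarrow> even j) = A $$ (r i, c j)"
    using conf by (rule configuration_inE) (auto simp: repeat_F_mat_index)
  have mem: "r i \<in> col_set A (c j) \<longleftrightarrow> (i < f \<longleftrightarrow> even j)" if "i < f + g" "j < t * 2" for i j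
    using that r(2) entry[OF that] by (auto simp: col_set_def of_bool_def split: if_splits)
  let ?S = "r ` {..<f}" and ?T = "r ` {f..<f + g}"
  have "c ` {j. j < t * 2 \<and> even j} \<subseteq> sep_cols A ?S ?T"
    using mem c(2) by (auto simp: sep_cols_def)
  then have "card (c ` {j. j < t * 2 \<and> even j}) \<le> card (sep_cols A ?S ?T)"
    by (intro card_mono) (auto simp: sep_cols_def)
  moreover have "c ` {j. j < t * 2 \<and> odd j} \<subseteq> sep_cols A ?T ?S"
    using mem c(2) by (auto simp: sep_cols_def)
  then have "card (c ` {j. j < t * 2 \<and> odd j}) \<le> card (sep_cols A ?T ?S)"
    by (intro card_mono) (auto simp: sep_cols_def)
  moreover have "card (c ` {j. j < t * 2 \<and> P j}) = card {j. j < t * 2 \<and> P j}" for P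
    by (intro card_image inj_on_subset[OF c(1)]) auto
  moreover have "card ?S = f" "card ?T = g"
    by (subst card_image, auto intro: inj_on_subset[OF r(1)])+
  ultimately show ?thesis
    by (intro crossingI[of ?S _ ?T])
      (simp_all add: card_even_less card_odd_less card_sep_cols[OF A])
qed

lemma configuration_in_of_sep_cols:
  assumes A: "zero_one_mat A"
    and rows: "S \<union> T \<subseteq> {..<dim_row A}" "S \<inter> T = {}" "card S = f" "card T = g"
    and J: "J \<subseteq> sep_cols A S T" "card J = t" and K: "K \<subseteq> sep_cols A T S" "card K = t"
    and JK: "J \<inter> K = {}"
  shows "configuration_in (repeat_mat t (F_mat 0 f g 0)) A"
proof -
  let ?even = "{j. j < t * 2 \<and> even j}" and ?odd = "{j. j < t * 2 \<and> odd j}"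
  have fin_rows: "finite S" "finite T" using rows(1) finite_subset by auto
  obtain r where r: "bij_betw r ({..<f} \<union> {f..<f + g}) (S \<union> T)"
      "r ` {..<f} = S" "r ` {f..<f + g} = T"
    by (rule ex_bij_betw_Un[of "{..<f}" "{f..<f + g}" S T]) (use rows fin_rows in auto)
  have "finite (sep_cols A P Q)" for P Q by (simp add: sep_cols_def)
  then have fin_cols: "finite J" "finite K" using J(1) K(1) by (auto intro: finite_subset)
  obtain c where c: "bij_betw c (?even \<union> ?odd) (J \<union> K)" "c ` ?even = J" "c ` ?odd = K"
    by (rule ex_bij_betw_Un[of ?even ?odd J K])
      (use J K JK fin_cols card_even_less card_odd_less in auto)
  have domains: "{..<f} \<union> {f..<f + g} = {..<f + g}" "?even \<union> ?odd = {..<t * 2}" by auto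
  show ?thesis
  proof (rule configuration_inI[of r _ _ c])
    fix i j
    assume "i < dim_row (repeat_mat t (F_mat 0 f g 0))" "j < dim_col (repeat_mat t (F_mat 0 f g 0))"
    then have i: "i < f + g" and j: "j < t * 2" by simp_all
    have "r i \<in> (if i < f then S else T)" using r(2,3) i by auto
    moreover have "c j \<in> (if even j then J else K)" using c(2,3) j by auto
    ultimately have "r i \<in> col_set A (c j) \<longleftrightarrow> (i < f \<longleftrightarrow> even j)" "r i < dim_row A" "c j < dim_col A"
      using J(1) K(1) rows(1) by (auto simp: sep_cols_def split: if_splits)
    then show "repeat_mat t (F_mat 0 f g 0) $$ (i, j) = A $$ (r i, c j)"
      using A i j by (simp add: repeat_F_mat_index zero_one_mat_entry)
  qed (use r(1) c(1) rows(1) J(1) K(1) in \<open>auto simp: domains bij_betw_def sep_cols_def\<close>)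
qed

lemma configuration_in_of_crossing:
  assumes A: "simple_mat A" and cross: "crossing f g t t (col_sets A)"
    and t: "t \<ge> 1" and fg: "f + g \<ge> 1"
  shows "configuration_in (repeat_mat t (F_mat 0 f g 0)) A"
proof -
  obtain S T where S: "finite S" "card S = f" and T: "finite T" "card T = g"
    and "t \<le> card (sep_cols A S T)" "t \<le> card (sep_cols A T S)"
    using cross unfolding crossing_def nsets_def card_sep_cols[OF A] by blast
  then obtain J K where J: "J \<subseteq> sep_cols A S T" "card J = t"
    and K: "K \<subseteq> sep_cols A T S" "card K = t"
    using obtain_subset_with_card_n[of t] by metis
  have "J \<noteq> {}" "K \<noteq> {}" using J K t by auto
  then have rows: "S \<union> T \<subseteq> {..<dim_row A}" "S \<inter> T = {}"
    using J(1) K(1) by (auto simp: sep_cols_def col_set_def)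
  have "S \<union> T \<noteq> {}" using S T fg by auto
  then have "sep_cols A S T \<inter> sep_cols A T S = {}" unfolding sep_cols_def by blast
  then have JK: "J \<inter> K = {}" using J(1) K(1) by blast
  have "zero_one_mat A" using A by (simp add: simple_mat_def)
  then show ?thesis using rows S(2) T(2) J K JK by (rule configuration_in_of_sep_cols)
qed

lemma forb_col_counts_repeat_F_mat:
  assumes "t \<ge> 1" "f + g \<ge> 1"
  shows "forb_col_counts m {repeat_mat t (F_mat 0 f g 0)} =
    card ` {\<F>. \<F> \<subseteq> Pow {..<m} \<and> \<not> crossing f g t t \<F>}" (is "?L = card ` ?\<C>")
proof
  show "?L \<subseteq> card ` ?\<C>"
  proof
    fix n assume "n \<in> ?L"
    then obtain A where A: "simple_mat A" "dim_row A = m" "dim_col A = n"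
      "\<not> configuration_in (repeat_mat t (F_mat 0 f g 0)) A"
      unfolding forb_col_counts_def by auto
    then have "col_sets A \<in> ?\<C>"
      using configuration_in_of_crossing[OF A(1) _ assms] by (auto simp: col_sets_def col_set_def)
    then show "n \<in> card ` ?\<C>" using card_col_sets[OF A(1)] A(3) by (metis imageI)
  qed
  show "card ` ?\<C> \<subseteq> ?L"
  proof (rule image_subsetI)
    fix \<F> assume \<F>: "\<F> \<in> ?\<C>"
    then obtain A where A: "simple_mat A" "dim_row A = m" "col_sets A = \<F>"
      using ex_simple_mat_col_sets[of \<F> m] by auto
    then have "\<not> configuration_in (repeat_mat t (F_mat 0 f g 0)) A"
      using crossing_of_configuration_in[OF A(1)] \<F> by auto
    then show "card \<F> \<in> ?L"
      using A card_col_sets[OF A(1)] unfolding forb_col_counts_def by auto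
  qed
qed

lemma forb_repeat_F_mat_le:
  assumes "t \<ge> 1" "m \<ge> 1"
  shows "forb m {repeat_mat t (F_mat 0 (Suc j) (Suc j) 0)} \<le> 8 * t * crossing_const j t * m ^ Suc j"
proof -
  let ?F = "repeat_mat t (F_mat 0 (Suc j) (Suc j) 0)"
  have "forb m {?F} \<in> forb_col_counts m {?F}"
    unfolding forb_def using assms
    by (intro Max_in finite_forb_col_counts forb_col_counts_nonempty) simp
  then obtain \<F> where "\<F> \<subseteq> Pow {..<m}" "\<not> crossing (Suc j) (Suc j) t t \<F>" "forb m {?F} = card \<F>"
    using assms by (auto simp: forb_col_counts_repeat_F_mat)
  then show ?thesis
    using card_le_of_not_crossing[of "{..<m}" \<F> j t] assms by (simp add: lessThan_empty_iff)
qed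

lemma not_crossing_nsets:
  assumes "t \<ge> 2"
  shows "\<not> crossing k b t s ([X]\<^bsup>k\<^esup>)"
proof
  assume "crossing k b t s ([X]\<^bsup>k\<^esup>)"
  then obtain S T where S: "card S = k" "finite S" and heavy: "t \<le> card (sep ([X]\<^bsup>k\<^esup>) S T)"
    by (auto simp: crossing_def nsets_def)
  have "sep ([X]\<^bsup>k\<^esup>) S T \<subseteq> {S}"
  proof
    fix A assume "A \<in> sep ([X]\<^bsup>k\<^esup>) S T"
    then have "S \<subseteq> A" "finite A" "card S = card A"
      using S by (simp_all add: sep_def nsets_def)
    then show "A \<in> {S}" using card_subset_eq[of A S] by simp
  qed
  then have "card (sep ([X]\<^bsup>k\<^esup>) S T) \<le> card {S}"
    by (intro card_mono) auto
  then show False using heavy assms by simp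
qed

lemma binomial_le_forb_repeat_F_mat:
  assumes "t \<ge> 2" "k \<ge> 1"
  shows "m choose k \<le> forb m {repeat_mat t (F_mat 0 k k 0)}"
proof -
  have "[{..<m}]\<^bsup>k\<^esup> \<in> {\<F>. \<F> \<subseteq> Pow {..<m} \<and> \<not> crossing k k t t \<F>}"
    using not_crossing_nsets[OF assms(1)] by (simp add: nsets_def Pow_def Collect_mono)
  then have "card ([{..<m}]\<^bsup>k\<^esup>) \<in> card ` {\<F>. \<F> \<subseteq> Pow {..<m} \<and> \<not> crossing k k t t \<F>}"
    by (rule imageI)
  also have "\<dots> = forb_col_counts m {repeat_mat t (F_mat 0 k k 0)}"
    using assms by (intro forb_col_counts_repeat_F_mat[symmetric]) auto
  finally have "card ([{..<m}]\<^bsup>k\<^esup>) \<le> forb m {repeat_mat t (F_mat 0 k k 0)}"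
    unfolding forb_def by (rule Max_ge[OF finite_forb_col_counts])
  then show ?thesis by (simp add: card_nsets)
qed

theorem theorem1:
  fixes t k :: nat
  assumes "t \<ge> 2" and "k \<ge> 1"
  shows "(\<lambda>m. real (forb m {repeat_mat t (F_mat 0 k k 0)})) \<in> \<Theta>(\<lambda>m. real m ^ k)"
proof
  let ?f = "\<lambda>m. forb m {repeat_mat t (F_mat 0 k k 0)}"
  obtain j where k: "k = Suc j" using assms(2) by (cases k) auto
  have "?f m \<le> 8 * t * crossing_const j t * m ^ k" if "m \<ge> 1" for m
    unfolding k using assms that by (intro forb_repeat_F_mat_le) auto
  then have "\<forall>\<^sub>F m in at_top.
      norm (real (?f m)) \<le> real (8 * t * crossing_const j t) * norm (real m ^ k)"
    by (intro eventually_mono[OF eventually_ge_at_top[of 1]]) (simp flip: of_nat_power of_nat_mult)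
  then show "(\<lambda>m. real (?f m)) \<in> O(\<lambda>m. real m ^ k)" by (rule bigoI)
  have "real m ^ k \<le> real k ^ k * real (?f m)" if "m \<ge> k" for m
  proof -
    have "(real m / real k) ^ k \<le> real (m choose k)" using that by (rule binomial_ge_n_over_k_pow_k)
    also have "\<dots> \<le> real (?f m)" using binomial_le_forb_repeat_F_mat[OF assms] by simp
    finally show ?thesis using assms by (simp add: power_divide field_simps)
  qed
  then have "\<forall>\<^sub>F m in at_top. norm (real m ^ k) \<le> real k ^ k * norm (real (?f m))"
    by (intro eventually_mono[OF eventually_ge_at_top[of k]]) simp
  then show "(\<lambda>m. real (?f m)) \<in> \<Omega>(\<lambda>m. real m ^ k)"
    unfolding bigomega_iff_bigo by (rule bigoI)
qed

end
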